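(* There exists $n_0$ such that for every integer $n\ge n_0$ the following holds with $a=32\log^6 n$: the number of graphs with vertex set $[n]$ containing at most $n^2/a$ cycles of length $4$ is at most $2^{11n^{3/2}}$.
   Context: Graphs are simple and labelled, $[n]=\{1,\ldots,n\}$. All logarithms have base 2, and $\log^6 n=(\log n)^6$. The number of 4-cycles is the number of subgraphs (not necessarily induced) isomorphic to the cycle of length 4. *)

theory Defs
  imports Complex_Main
begin

type_synonym 'a graph = "'a set \<times> 'a set set"

abbreviation verts :: "'a graph \<Rightarrow> 'a set" where "verts G \<equiv> fst G"

abbreviation edges :: "'a graph \<Rightarrow> 'a set set" where "edges G \<equiv> snd G"

definition simple_graph :: "'a graph \<Rightarrow> bool" where
  "simple_graph G \<longleftrightarrow> finite (verts G) \<and> (\<forall>e\<in>edges G. e \<subseteq> verts G \<and> card e = 2)"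

definition graphs_on :: "'a set \<Rightarrow> 'a graph set" where
  "graphs_on V = {G. simple_graph G \<and> verts G = V}"

definition subgraph :: "'a graph \<Rightarrow> 'a graph \<Rightarrow> bool" where
  "subgraph H G \<longleftrightarrow> simple_graph H \<and> verts H \<subseteq> verts G \<and> edges H \<subseteq> edges G"

definition graph_isomorphic :: "'a graph \<Rightarrow> 'b graph \<Rightarrow> bool" where
  "graph_isomorphic G H \<longleftrightarrow>
     (\<exists>f. bij_betw f (verts G) (verts H) \<and> (\<lambda>e. f ` e) ` edges G = edges H)"

text \<open>A simple graph only for \<open>k \<ge> 3\<close>.\<close>
definition cycle_graph :: "nat \<Rightarrow> nat graph" where
  "cycle_graph k = ({..<k}, {{i, Suc i mod k} | i. i < k})"

text \<open>Copies are counted as subgraphs, not as vertex tuples or vertex sets: the complete graph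
  on four vertices has three 4-cycles.\<close>
definition cycles_of_length :: "nat \<Rightarrow> 'a graph \<Rightarrow> 'a graph set" where
  "cycles_of_length k G = {H. subgraph H G \<and> graph_isomorphic H (cycle_graph k)}"

text \<open>The next two lemmas guard against \<^const>\<open>card\<close> being 0 because a set is infinite.\<close>

lemma finite_graphs_on:
  assumes "finite V"
  shows "finite (graphs_on V)"
proof (rule finite_subset)
  show "graphs_on V \<subseteq> {V} \<times> Pow (Pow V)"
    by (auto simp: graphs_on_def simple_graph_def)
  show "finite ({V} \<times> Pow (Pow V))"
    using assms by simp
qed

lemma finite_cycles_of_length:
  assumes "simple_graph G"
  shows "finite (cycles_of_length k G)"
proof (rule finite_subset)
  show "cycles_of_length k G \<subseteq> Pow (verts G) \<times> Pow (Pow (verts G))"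
    using assms by (fastforce simp: cycles_of_length_def subgraph_def simple_graph_def)
  show "finite (Pow (verts G) \<times> Pow (Pow (verts G)))"
    using assms by (simp add: simple_graph_def)
qed

lemma simple_graph_cycle_graph:
  assumes "k \<ge> 3"
  shows "simple_graph (cycle_graph k)"
proof -
  have "i \<noteq> Suc i mod k" if "i < k" for i
    using that assms by (cases "Suc i = k") auto
  then show ?thesis
    using assms by (auto simp: simple_graph_def cycle_graph_def card_2_iff)
qed

end

theory Submission
  imports Defs "HOL-Analysis.Analysis" "HOL-Real_Asymp.Real_Asymp"
begin

text \<open>
  Write \<open>L = log 2 n\<close> and call an edge heavy if more than \<open>T = 8 * sqrt n / L ^ 5\<close> 4-cycles pass through
  it. A graph with at most \<open>n\<^sup>2 / (32 * L ^ 6)\<close> 4-cycles has at most \<open>n powr (3/2) / L\<close> heavy edges, so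
  their choice costs only a factor \<open>2 powr (2 * n powr (3/2))\<close>. Deleting them leaves a graph in which
  every edge lies on at most \<open>T\<close> 4-cycles (\<open>card_few_C4s_le\<close>). This property passes to induced
  subgraphs, and it makes the method of Kleitman and Winston for counting graphs without 4-cycles
  robust. A bound on the total number of 4-cycles would not do: the 4-cycles of the graph could be
  concentrated in such a way that a single new vertex has far too many admissible neighbourhoods.

  A locally sparse graph is built one vertex at a time, each new vertex having minimum degree in the
  graph built so far (\<open>card_locally_sparse_le\<close>). If the new vertex has neighbourhood \<open>N\<close>, the old
  graph has minimum degree at least \<open>card N - 1\<close>, and for every \<open>x\<close> in \<open>N\<close> the codegrees of \<open>x\<close> with the
  other vertices of \<open>N\<close> add up to at most \<open>T\<close>. Sets with the latter property are counted by
  \<open>card_light_sets_le\<close>: a short list of selected vertices of \<open>N\<close>, each of large codegree sum in the current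
  ground set, confines the rest of \<open>N\<close> to a small set. High minimum degree provides such vertices
  (\<open>exists_large_codeg_sum\<close>), and with low minimum degree \<open>N\<close> itself is small enough. The lists
  have about \<open>L ^ 3 * T\<close> entries, up to a constant factor, and the choice of \<open>T\<close> makes this \<open>O(sqrt n / L\<^sup>2)\<close>, so they contribute only \<open>2 powr o(sqrt n)\<close>. If \<open>d\<close> is
  the minimum degree, the small set has fewer than \<open>2 * n / d\<close> vertices and \<open>N\<close> has at most about \<open>d\<close>; the
  product of these sizes does not depend on \<open>d\<close>, which leaves at most \<open>exp (4 * sqrt n)\<close> possibilities
  for the rest of \<open>N\<close> (\<open>card_subsets_le_exp_sqrt\<close>).

  So each of the \<open>n\<close> vertices contributes at most \<open>8 * sqrt n\<close> bits for its neighbourhood and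
  \<open>L \<le> sqrt n\<close> bits for its identity. Together with the heavy edges this makes
  \<open>(8 + 1 + 2) * n powr (3/2)\<close> bits.
\<close>

section \<open>Counting subsets of bounded size\<close>

lemma card_subsets_le_power:
  assumes "finite A"
  shows "card {B. B \<subseteq> A \<and> card B \<le> m} \<le> (card A + 1) ^ m"
  using assms
proof (induction A arbitrary: m rule: finite_induct)
  case empty
  have "{B::'a set. B \<subseteq> {} \<and> card B \<le> m} = {{}}"
    by auto
  then show ?case
    by simp
next
  case (insert a A)
  define F where "F C m = {B. B \<subseteq> C \<and> card B \<le> m}" for C :: "'a set" and m
  show ?case
  proof (cases m)
    case 0
    have "{B. B \<subseteq> insert a A \<and> card B \<le> 0} = {{}}"
      using insert.hyps by (auto dest: finite_subset)
    then show ?thesis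
      using 0 by simp
  next
    case (Suc m')
    have "F (insert a A) (Suc m') \<subseteq> F A (Suc m') \<union> insert a ` F A m'"
    proof
      fix B
      assume B: "B \<in> F (insert a A) (Suc m')"
      show "B \<in> F A (Suc m') \<union> insert a ` F A m'"
      proof (cases "a \<in> B")
        case True
        have "finite B"
          using B insert.hyps by (auto simp: F_def dest: finite_subset)
        then have "B - {a} \<in> F A m'"
          using B True by (auto simp: F_def)
        moreover have "B = insert a (B - {a})"
          using True by auto
        ultimately show ?thesis
          by blast
      qed (use B in \<open>auto simp: F_def\<close>)
    qed
    moreover have fin: "finite (F A k)" for k
      using insert.hyps by (auto simp: F_def)
    ultimately have "card (F (insert a A) (Suc m')) \<le> card (F A (Suc m') \<union> insert a ` F A m')"
      by (intro card_mono) auto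
    also have "\<dots> \<le> card (F A (Suc m')) + card (F A m')"
      using card_Un_le card_image_le[OF fin] by (meson add_left_mono le_trans)
    also have "\<dots> \<le> (card A + 1) ^ Suc m' + (card A + 1) ^ m'"
      unfolding F_def by (intro add_mono insert.IH)
    also have "\<dots> = (card A + 2) * (card A + 1) ^ m'"
      by (simp add: algebra_simps)
    also have "\<dots> \<le> (card A + 2) * (card A + 2) ^ m'"
      by (intro mult_left_mono power_mono) auto
    finally show ?thesis
      using Suc insert.hyps by (simp add: F_def)
  qed
qed

text \<open>
  Here the exponent is symmetric in the size of the ground set and the size of the chosen subsets, so
  only their product matters. For \<open>k \<le> card A = r\<close> every chosen subset \<open>B\<close> satisfies
  \<open>y ^ k \<le> y ^ card B\<close> when \<open>0 < y \<le> 1\<close>, so the binomial theorem bounds the count by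
  \<open>(1 + y) ^ r / y ^ k\<close>; the choice \<open>y = sqrt (k / r)\<close> balances the two factors.
\<close>

lemma card_subsets_le_exp_sqrt:
  assumes "finite A"
  shows "real (card {B. B \<subseteq> A \<and> card B \<le> k}) \<le> exp (2 * sqrt (real (card A) * real k))"
proof -
  define r where "r = card A"
  have fin: "finite {B. B \<subseteq> A \<and> card B \<le> k}"
    using assms by auto
  consider "k = 0" | "k > r" | "0 < k" "k \<le> r"
    by linarith
  then show ?thesis
  proof cases
    case 1
    have "{B. B \<subseteq> A \<and> card B \<le> k} = {{}}"
      using assms 1 by (auto dest: finite_subset)
    then show ?thesis
      using 1 by simp
  next
    case 2
    have "card {B. B \<subseteq> A \<and> card B \<le> k} \<le> card (Pow A)"
      using assms by (intro card_mono) auto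
    then have "real (card {B. B \<subseteq> A \<and> card B \<le> k}) \<le> 2 ^ r"
      using assms by (simp add: card_Pow r_def)
    also have "\<dots> \<le> exp 1 ^ r"
      using exp_ge_add_one_self[of 1] by (intro power_mono) auto
    also have "\<dots> = exp (real r)"
      by (simp flip: exp_of_nat_mult)
    also have "\<dots> \<le> exp (2 * sqrt (real r * real k))"
    proof -
      have "real r = sqrt (real r * real r)"
        by simp
      also have "\<dots> \<le> sqrt (real r * real k)"
        using 2 by (intro real_sqrt_le_mono mult_left_mono) auto
      also have "\<dots> \<le> 2 * sqrt (real r * real k)"
        by simp
      finally show ?thesis
        by simp
    qed
    finally show ?thesis
      by (simp add: r_def)
  next
    case 3
    define y where "y = sqrt (real k / real r)"
    have y: "0 < y" "y \<le> 1"
      using 3 by (auto simp: y_def)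
    have "real (card {B. B \<subseteq> A \<and> card B \<le> k}) * y ^ k = (\<Sum>B | B \<subseteq> A \<and> card B \<le> k. y ^ k)"
      by simp
    also have "\<dots> \<le> (\<Sum>B | B \<subseteq> A \<and> card B \<le> k. y ^ card B)"
      using y by (intro sum_mono power_decreasing) auto
    also have "\<dots> \<le> (\<Sum>B\<in>Pow A. y ^ card B)"
      using y assms by (intro sum_mono2) auto
    also have "\<dots> = (\<Sum>B\<in>Pow A. (\<Prod>b\<in>B. y) * (\<Prod>b\<in>A - B. 1))"
      by simp
    also have "\<dots> = (\<Prod>b\<in>A. y + 1)"
      using prod_add[OF assms, of "\<lambda>_. y" "\<lambda>_. 1"] by simp
    also have "\<dots> = (1 + y) ^ r"
      by (simp add: r_def add.commute)
    also have "\<dots> \<le> exp y ^ r"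
      using y exp_ge_add_one_self[of y] by (intro power_mono) auto
    also have "\<dots> = exp (real r * y)"
      by (simp flip: exp_of_nat_mult)
    also have "real r * y = sqrt (real r * real k)"
      using 3 by (simp add: y_def real_sqrt_divide real_sqrt_mult real_div_sqrt field_simps)
    finally have 1: "real (card {B. B \<subseteq> A \<and> card B \<le> k}) * y ^ k \<le> exp (sqrt (real r * real k))" .
    have "1 / y \<le> exp (1 / y)"
      using exp_ge_add_one_self[of "1 / y"] by linarith
    then have "(1 / y) ^ k \<le> exp (1 / y) ^ k"
      using y by (intro power_mono) auto
    also have "\<dots> = exp (real k * (1 / y))"
      by (simp flip: exp_of_nat_mult)
    also have "real k * (1 / y) = sqrt (real r * real k)"
      using 3 by (simp add: y_def real_sqrt_divide real_sqrt_mult real_div_sqrt field_simps)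
    finally have 2: "(1 / y) ^ k \<le> exp (sqrt (real r * real k))" .
    have "real (card {B. B \<subseteq> A \<and> card B \<le> k})
        = real (card {B. B \<subseteq> A \<and> card B \<le> k}) * y ^ k * (1 / y) ^ k"
      using y by (simp add: power_divide)
    also have "\<dots> \<le> exp (sqrt (real r * real k)) * exp (sqrt (real r * real k))"
      using y by (intro mult_mono 1 2) auto
    also have "\<dots> = exp (2 * sqrt (real r * real k))"
      by (simp flip: exp_add)
    finally show ?thesis
      by (simp add: r_def)
  qed
qed

section \<open>A weighted Kleitman--Winston lemma\<close>

text \<open>
  The field \<open>u\<close> records the weight that a vertex already receives from selected vertices which have been
  removed from the ground set. With it the family is closed under selecting and deleting a vertex.
\<close>

definition light_sets ::
    "('a \<Rightarrow> 'a \<Rightarrow> real) \<Rightarrow> real \<Rightarrow> nat \<Rightarrow> ('a \<Rightarrow> real) \<Rightarrow> 'a set \<Rightarrow> 'a set set" where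
  "light_sets w T k u A =
     {N. N \<subseteq> A \<and> card N \<le> k \<and> (\<forall>x\<in>N. u x + (\<Sum>y\<in>N - {x}. w x y) \<le> T)}"

lemma finite_light_sets: "finite A \<Longrightarrow> finite (light_sets w T k u A)"
  by (simp add: light_sets_def)

text \<open>
  A light set that contains \<open>v\<close> can only use vertices at which the field, increased by the weight to \<open>v\<close>,
  does not exceed \<open>T\<close>: selecting \<open>v\<close> discards all others.
\<close>

lemma light_sets_split:
  fixes w :: "'a \<Rightarrow> 'a \<Rightarrow> real" and u :: "'a \<Rightarrow> real"
  assumes "finite A" "v \<in> A" "\<And>x y. w x y \<ge> 0"
  defines "u' \<equiv> (\<lambda>x. u x + w x v)"
  shows "light_sets w T k u A \<subseteq> light_sets w T k u (A - {v})
    \<union> insert v ` light_sets w T k u' {x \<in> A - {v}. u' x \<le> T}"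
proof
  fix N
  assume N: "N \<in> light_sets w T k u A"
  then have fin: "finite N"
    using assms(1) by (auto simp: light_sets_def dest: finite_subset)
  show "N \<in> light_sets w T k u (A - {v})
    \<union> insert v ` light_sets w T k u' {x \<in> A - {v}. u' x \<le> T}"
  proof (cases "v \<in> N")
    case False
    then show ?thesis
      using N by (auto simp: light_sets_def)
  next
    case True
    have field: "u' x + (\<Sum>y\<in>N - {v} - {x}. w x y) \<le> T" if "x \<in> N - {v}" for x
    proof -
      have "(\<Sum>y\<in>N - {x}. w x y) = w x v + (\<Sum>y\<in>N - {x} - {v}. w x y)"
        using fin True that by (intro sum.remove) auto
      moreover have "N - {x} - {v} = N - {v} - {x}"
        by auto
      moreover have "u x + (\<Sum>y\<in>N - {x}. w x y) \<le> T"
        using N that by (auto simp: light_sets_def)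
      ultimately show ?thesis
        by (simp add: u'_def)
    qed
    moreover have "u' x \<le> T" if "x \<in> N - {v}" for x
    proof -
      have "(\<Sum>y\<in>N - {v} - {x}. w x y) \<ge> 0"
        by (intro sum_nonneg assms)
      then show ?thesis
        using field[OF that] by simp
    qed
    moreover have "card (N - {v}) \<le> k"
      using N fin by (auto simp: light_sets_def intro: le_trans[OF card_Diff1_le])
    ultimately have "N - {v} \<in> light_sets w T k u' {x \<in> A - {v}. u' x \<le> T}"
      using N by (auto simp: light_sets_def)
    moreover have "N = insert v (N - {v})"
      using True by auto
    ultimately show ?thesis
      by blast
  qed
qed

text \<open>
  Branch on whether a vertex \<open>v\<close> of large weighted degree in the current ground set is selected, until
  fewer than \<open>R\<close> vertices are left. The progress is measured by the potential
  \<open>\<Sum>x\<in>A. T + B - u x\<close>. Since \<open>0 \<le> u \<le> T\<close> on the ground set \<open>A\<close>, it lies between \<open>B * card A\<close> and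
  \<open>(T + B) * card A\<close>. Selecting \<open>v\<close> raises the field by at least \<open>\<beta> * card A\<close> in total, so the
  potential shrinks by the factor \<open>1 - \<beta> / (T + B)\<close>; discarding a vertex whose field now exceeds \<open>T\<close>
  does not increase the potential because one selection raises the field by at most \<open>B\<close>. Hence a branch
  has at most \<open>q\<close> selections before fewer than \<open>R\<close> vertices remain. There are few ways to choose
  these selections, and \<open>M\<close> bounds the choices for the rest of the set.
\<close>

lemma card_light_sets_le:
  fixes w :: "'a \<Rightarrow> 'a \<Rightarrow> real" and T B \<beta> R M :: real
  assumes "finite A"
    and w: "\<And>x y. w x y \<ge> 0" "\<And>x y. w x y = w y x" "\<And>x y. x \<noteq> y \<Longrightarrow> w x y \<le> B"
    and const: "0 < B" "0 \<le> T" "0 \<le> \<beta>" "\<beta> \<le> T + B"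
    and u: "\<And>x. x \<in> A \<Longrightarrow> u x \<le> T" "\<And>x. x \<in> A \<Longrightarrow> 0 \<le> u x"
    and dense: "\<And>C. C \<subseteq> A \<Longrightarrow> R \<le> real (card C) \<Longrightarrow>
      \<exists>v\<in>C. \<beta> * real (card C) \<le> (\<Sum>y\<in>C - {v}. w v y)"
    and small: "\<And>C. C \<subseteq> A \<Longrightarrow> real (card C) < R \<Longrightarrow>
      real (card {N. N \<subseteq> C \<and> card N \<le> k}) \<le> M"
    and "0 \<le> M"
    and potential: "(\<Sum>x\<in>A. T + B - u x) * (1 - \<beta> / (T + B)) ^ q < B * R"
  shows "real (card (light_sets w T k u A)) \<le> (real (card A) + 1) ^ q * M"
  using \<open>finite A\<close> u(1) dense small u(2) potential
proof (induction "card A" arbitrary: A u q rule: less_induct)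
  case less
  define S where "S = T + B"
  define m where "m = card A"
  have S: "0 < S" "\<beta> / S \<le> 1" "0 \<le> \<beta> / S"
    using const by (auto simp: S_def)
  show ?case
  proof (cases "real m < R")
    case True
    have "card (light_sets w T k u A) \<le> card {N. N \<subseteq> A \<and> card N \<le> k}"
      using less.prems(1) by (intro card_mono) (auto simp: light_sets_def)
    also have "real \<dots> \<le> M"
      using True by (intro less.prems) (auto simp: m_def)
    also have "M \<le> (real m + 1) ^ q * M"
      using \<open>0 \<le> M\<close> mult_right_mono[of 1 "(real m + 1) ^ q" M] by simp
    finally show ?thesis
      by (simp add: m_def)
  next
    case False
    then obtain v where v: "v \<in> A" "\<beta> * real m \<le> (\<Sum>y\<in>A - {v}. w v y)"
      using less.prems(3)[of A] by (auto simp: m_def)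
    have pot_ge: "B * real m \<le> (\<Sum>x\<in>A. S - u x)"
      using sum_mono[of A "\<lambda>_. B" "\<lambda>x. S - u x"] less.prems(2)
      by (auto simp: S_def m_def algebra_simps)
    have pot_le: "(\<Sum>x\<in>A. S - u x) \<le> S * real m"
      using sum_mono[of A "\<lambda>x. S - u x" "\<lambda>_. S"] less.prems(5)
      by (auto simp: m_def algebra_simps)
    have "q \<noteq> 0"
    proof
      assume "q = 0"
      then have "(\<Sum>x\<in>A. S - u x) < B * R"
        using less.prems(6) by (simp add: S_def)
      then have "B * real m < B * R"
        using pot_ge by linarith
      then show False
        using False const by simp
    qed
    then obtain q' where q: "q = Suc q'"
      using not0_implies_Suc by blast
    define u' where "u' = (\<lambda>x. u x + w x v)"
    define A1 where "A1 = A - {v}"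
    define A2 where "A2 = {x \<in> A1. u' x \<le> T}"
    have sub: "A1 \<subseteq> A" "A2 \<subseteq> A" "A2 \<subseteq> A1"
      by (auto simp: A1_def A2_def)
    have fin: "finite A1" "finite A2"
      using less.prems(1) by (auto simp: A1_def A2_def)
    have c1: "0 < m" "card A1 = m - 1" "card A1 < card A"
      using v less.prems(1) card_Diff1_less[of A v] by (auto simp: A1_def m_def card_gt_0_iff)
    have c2: "card A2 \<le> card A1" "card A2 < card A"
      using card_mono[OF fin(1) sub(3)] c1 by auto
    have "(\<Sum>x\<in>A1. S - u x) \<le> (\<Sum>x\<in>A. S - u x)"
    proof (intro sum_mono2 less.prems(1) sub)
      show "0 \<le> S - u x" if "x \<in> A - A1" for x
        using less.prems(2)[of x] that const by (simp add: S_def)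
    qed
    then have "(\<Sum>x\<in>A1. S - u x) * (1 - \<beta> / S) ^ q \<le> (\<Sum>x\<in>A. S - u x) * (1 - \<beta> / S) ^ q"
      using S by (intro mult_right_mono) auto
    also have "\<dots> < B * R"
      using less.prems(6) by (simp only: S_def)
    finally have pot1: "(\<Sum>x\<in>A1. S - u x) * (1 - \<beta> / S) ^ q < B * R" .
    have IH1: "real (card (light_sets w T k u A1)) \<le> (real (card A1) + 1) ^ q * M"
    proof (rule less.hyps[OF c1(3) fin(1)])
      show "\<exists>v\<in>C. \<beta> * real (card C) \<le> (\<Sum>y\<in>C - {v}. w v y)"
        if "C \<subseteq> A1" "R \<le> real (card C)" for C
        using less.prems(3) that sub by blast
      show "real (card {N. N \<subseteq> C \<and> card N \<le> k}) \<le> M" if "C \<subseteq> A1" "real (card C) < R" for C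
        using less.prems(4) that sub by blast
    qed (use less.prems(2,5) sub pot1 in \<open>auto simp: S_def\<close>)
    have "(\<Sum>x\<in>A2. S - u' x) \<le> (\<Sum>x\<in>A1. S - u' x)"
    proof (intro sum_mono2 fin sub)
      fix x
      assume "x \<in> A1 - A2"
      then have "x \<in> A" "x \<noteq> v"
        by (auto simp: A1_def)
      then show "0 \<le> S - u' x"
        using less.prems(2)[of x] w(3)[of x v] by (auto simp: u'_def S_def)
    qed
    also have "\<dots> = (\<Sum>x\<in>A1. S - u x) - (\<Sum>x\<in>A1. w v x)"
      by (simp add: u'_def sum_subtractf sum.distrib w(2)[of _ v])
    also have "\<dots> \<le> (\<Sum>x\<in>A. S - u x) - \<beta> * real m"
      using \<open>(\<Sum>x\<in>A1. S - u x) \<le> _\<close> v by (simp add: A1_def)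
    also have "\<dots> \<le> (\<Sum>x\<in>A. S - u x) - \<beta> / S * (\<Sum>x\<in>A. S - u x)"
      using mult_left_mono[OF pot_le S(3)] S(1) by simp
    also have "\<dots> = (\<Sum>x\<in>A. S - u x) * (1 - \<beta> / S)"
      by (simp add: algebra_simps)
    finally have "(\<Sum>x\<in>A2. S - u' x) * (1 - \<beta> / S) ^ q'
        \<le> (\<Sum>x\<in>A. S - u x) * (1 - \<beta> / S) * (1 - \<beta> / S) ^ q'"
      using S by (intro mult_right_mono) auto
    also have "\<dots> < B * R"
      using less.prems(6) by (simp add: S_def q mult_ac)
    finally have pot2: "(\<Sum>x\<in>A2. S - u' x) * (1 - \<beta> / S) ^ q' < B * R" .
    have IH2: "real (card (light_sets w T k u' A2)) \<le> (real (card A2) + 1) ^ q' * M"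
    proof (rule less.hyps[OF c2(2) fin(2)])
      show "\<exists>v\<in>C. \<beta> * real (card C) \<le> (\<Sum>y\<in>C - {v}. w v y)"
        if "C \<subseteq> A2" "R \<le> real (card C)" for C
        using less.prems(3) that sub by blast
      show "real (card {N. N \<subseteq> C \<and> card N \<le> k}) \<le> M" if "C \<subseteq> A2" "real (card C) < R" for C
        using less.prems(4) that sub by blast
    qed (use less.prems(5) sub w(1) pot2 in \<open>auto simp: S_def A2_def u'_def\<close>)
    have finl: "finite (light_sets w T k u A1)" "finite (light_sets w T k u' A2)"
      by (intro finite_light_sets fin)+
    have "card (light_sets w T k u A)
        \<le> card (light_sets w T k u A1 \<union> insert v ` light_sets w T k u' A2)"
      using light_sets_split[where w = w and T = T and k = k and u = u, OF less.prems(1) v(1) w(1)] finl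
      by (intro card_mono) (auto simp: A1_def A2_def u'_def)
    also have "\<dots> \<le> card (light_sets w T k u A1) + card (light_sets w T k u' A2)"
      using card_Un_le card_image_le[OF finl(2)] by (meson add_left_mono le_trans)
    finally have "real (card (light_sets w T k u A))
        \<le> real (card (light_sets w T k u A1)) + real (card (light_sets w T k u' A2))"
      by linarith
    also have "\<dots> \<le> real m ^ q * M + real m ^ q' * M"
    proof (intro add_mono)
      show "real (card (light_sets w T k u A1)) \<le> real m ^ q * M"
        using IH1 c1 by simp
      have "(real (card A2) + 1) ^ q' \<le> real m ^ q'"
        using c1 c2 by (intro power_mono) auto
      then show "real (card (light_sets w T k u' A2)) \<le> real m ^ q' * M"
        using IH2 \<open>0 \<le> M\<close> by (meson mult_right_mono order_trans)
    qed
    also have "\<dots> = (real m + 1) * real m ^ q' * M"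
      by (simp add: q algebra_simps)
    also have "\<dots> \<le> (real m + 1) * (real m + 1) ^ q' * M"
      using \<open>0 \<le> M\<close> by (intro mult_right_mono mult_left_mono power_mono) auto
    finally show ?thesis
      by (simp add: q m_def)
  qed
qed

section \<open>Locally sparse graphs\<close>

definition nbrs :: "'a set set \<Rightarrow> 'a \<Rightarrow> 'a set" where
  "nbrs E v = {x. {v, x} \<in> E}"

definition codeg :: "'a set set \<Rightarrow> 'a \<Rightarrow> 'a \<Rightarrow> nat" where
  "codeg E x y = card (nbrs E x \<inter> nbrs E y)"

text \<open>
  For an edge \<open>{v, x}\<close>, the pair \<open>(y, z)\<close> stands for the 4-cycle that visits \<open>v, y, z, x\<close> in this order.
\<close>

definition C4s_through :: "'a set set \<Rightarrow> 'a \<Rightarrow> 'a \<Rightarrow> ('a \<times> 'a) set" where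
  "C4s_through E v x =
     {(y, z). {v, y} \<in> E \<and> {y, z} \<in> E \<and> {z, x} \<in> E \<and> y \<noteq> x \<and> z \<noteq> v}"

definition locally_sparse :: "real \<Rightarrow> 'a set \<Rightarrow> 'a set set set" where
  "locally_sparse T W = {E. simple_graph (W, E) \<and>
     (\<forall>v x. {v, x} \<in> E \<longrightarrow> real (card (C4s_through E v x)) \<le> T)}"

lemma nbrs_iff: "x \<in> nbrs E v \<longleftrightarrow> {v, x} \<in> E"
  by (simp add: nbrs_def)

lemma nbrs_subset:
  assumes "simple_graph (W, E)"
  shows "nbrs E v \<subseteq> W - {v}"
  using assms by (fastforce simp: nbrs_def simple_graph_def)

lemma finite_nbrs:
  assumes "simple_graph (W, E)"
  shows "finite (nbrs E v)"
  using nbrs_subset[OF assms] assms by (auto simp: simple_graph_def intro: finite_subset)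

lemma edge_ends:
  assumes "simple_graph (W, E)" "{v, x} \<in> E"
  shows "v \<in> W" "x \<in> W" "v \<noteq> x"
  using assms by (fastforce simp: simple_graph_def)+

lemma finite_C4s_through:
  assumes "simple_graph (W, E)"
  shows "finite (C4s_through E v x)"
proof (rule finite_subset)
  show "C4s_through E v x \<subseteq> W \<times> W"
    using edge_ends[OF assms] by (auto simp: C4s_through_def)
  show "finite (W \<times> W)"
    using assms by (simp add: simple_graph_def)
qed

lemma C4s_through_mono: "E' \<subseteq> E \<Longrightarrow> C4s_through E' v x \<subseteq> C4s_through E v x"
  by (auto simp: C4s_through_def)

lemma simple_graph_subgraph:
  assumes "simple_graph (W, E)" "E' \<subseteq> E" "W' \<subseteq> W" "\<And>e. e \<in> E' \<Longrightarrow> e \<subseteq> W'"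
  shows "simple_graph (W', E')"
  using assms by (auto simp: simple_graph_def dest: finite_subset)

lemma locally_sparse_mono:
  assumes "E \<in> locally_sparse T W" "E' \<subseteq> E" "W' \<subseteq> W" "\<And>e. e \<in> E' \<Longrightarrow> e \<subseteq> W'"
  shows "E' \<in> locally_sparse T W'"
proof -
  have E: "simple_graph (W, E)"
    using assms by (simp add: locally_sparse_def)
  have "real (card (C4s_through E' v x)) \<le> T" if "{v, x} \<in> E'" for v x
  proof -
    have "card (C4s_through E' v x) \<le> card (C4s_through E v x)"
      by (intro card_mono finite_C4s_through[OF E] C4s_through_mono assms)
    moreover have "real (card (C4s_through E v x)) \<le> T"
      using assms that by (auto simp: locally_sparse_def)
    ultimately show ?thesis
      by linarith
  qed
  then show ?thesis
    using simple_graph_subgraph[OF E] assms by (auto simp: locally_sparse_def)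
qed

lemma codeg_commute: "codeg E x y = codeg E y x"
  by (simp add: codeg_def Int_commute)

text \<open>
  If \<open>z\<close> is a common neighbour of \<open>x\<close> and \<open>y\<close>, every other common neighbour closes a 4-cycle through
  the edge \<open>{z, x}\<close>.
\<close>

lemma codeg_le:
  assumes E: "E \<in> locally_sparse T W" and "x \<noteq> y" "0 \<le> T"
  shows "real (codeg E x y) \<le> T + 1"
proof (cases "nbrs E x \<inter> nbrs E y = {}")
  case True
  then show ?thesis
    using assms by (simp add: codeg_def)
next
  case False
  then obtain z where z: "z \<in> nbrs E x" "z \<in> nbrs E y"
    by blast
  have G: "simple_graph (W, E)"
    using E by (simp add: locally_sparse_def)
  have "Pair y ` (nbrs E x \<inter> nbrs E y - {z}) \<subseteq> C4s_through E z x"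
    using z \<open>x \<noteq> y\<close> by (auto simp: C4s_through_def nbrs_iff insert_commute)
  then have "card (Pair y ` (nbrs E x \<inter> nbrs E y - {z})) \<le> card (C4s_through E z x)"
    by (intro card_mono finite_C4s_through[OF G])
  also have "card (Pair y ` (nbrs E x \<inter> nbrs E y - {z})) = card (nbrs E x \<inter> nbrs E y - {z})"
    by (intro card_image) (auto simp: inj_on_def)
  also have "\<dots> = codeg E x y - 1"
    using z finite_nbrs[OF G] by (simp add: codeg_def)
  finally have "codeg E x y - 1 \<le> card (C4s_through E z x)" .
  moreover have "real (card (C4s_through E z x)) \<le> T"
    using E z by (auto simp: locally_sparse_def nbrs_iff insert_commute)
  ultimately show ?thesis
    by linarith
qed

text \<open>
  Count walks of length two with both ends in \<open>A\<close> by their midpoints. The degrees of the vertices of \<open>A\<close>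
  add up to at least \<open>d * card A \<ge> 2 * n\<close>, an average of at least two per midpoint. By
  Cauchy--Schwarz at most half of the walks counted are degenerate, that is, return to their
  starting point, and some vertex of \<open>A\<close> has its share of the others.
\<close>

lemma exists_large_codeg_sum:
  fixes d n :: real
  assumes G: "simple_graph (W, E)" and n: "real (card W) \<le> n" "0 < n"
    and d: "\<And>x. x \<in> W \<Longrightarrow> d \<le> real (card (nbrs E x))" "0 < d"
    and A: "A \<subseteq> W" "2 * n / d \<le> real (card A)"
  shows "\<exists>v\<in>A. d\<^sup>2 / (2 * n) * real (card A) \<le> (\<Sum>y\<in>A - {v}. real (codeg E v y))"
proof (rule ccontr)
  assume neg: "\<not> ?thesis"
  define a where "a x z = (of_bool (z \<in> nbrs E x) :: real)" for x z
  define D where "D = (\<Sum>x\<in>A. real (card (nbrs E x)))"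
  have fin: "finite W" "finite A"
    using G A by (auto simp: simple_graph_def dest: finite_subset)
  have "0 < 2 * n / d"
    using n d by simp
  then have "A \<noteq> {}"
    using A by auto
  have deg: "real (card (nbrs E x)) = (\<Sum>z\<in>W. a x z)" for x
  proof -
    have "W \<inter> {z. z \<in> nbrs E x} = nbrs E x"
      using nbrs_subset[OF G, of x] by auto
    then show ?thesis
      using fin by (simp add: a_def)
  qed
  have cod: "real (codeg E x y) = (\<Sum>z\<in>W. a x z * a y z)" for x y
  proof -
    have "W \<inter> {z. z \<in> nbrs E x \<and> z \<in> nbrs E y} = nbrs E x \<inter> nbrs E y"
      using nbrs_subset[OF G, of x] by auto
    then show ?thesis
      using fin by (simp add: a_def codeg_def flip: of_bool_conj)
  qed
  have D_eq: "D = (\<Sum>z\<in>W. \<Sum>x\<in>A. a x z)"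
    unfolding D_def deg by (rule sum.swap)
  have D_ge: "d * real (card A) \<le> D"
    using sum_mono[of A "\<lambda>_. d" "\<lambda>x. real (card (nbrs E x))"] d A by (auto simp: D_def mult.commute)
  then have "2 * n \<le> D"
    using A d by (simp add: field_simps)
  have "(\<Sum>x\<in>A. \<Sum>y\<in>A. real (codeg E x y)) = (\<Sum>z\<in>W. (\<Sum>x\<in>A. a x z)\<^sup>2)"
  proof -
    have "(\<Sum>x\<in>A. \<Sum>y\<in>A. real (codeg E x y)) = (\<Sum>x\<in>A. \<Sum>z\<in>W. \<Sum>y\<in>A. a x z * a y z)"
      unfolding cod by (intro sum.cong refl sum.swap)
    also have "\<dots> = (\<Sum>z\<in>W. \<Sum>x\<in>A. \<Sum>y\<in>A. a x z * a y z)"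
      by (rule sum.swap)
    finally show ?thesis
      by (simp add: power2_eq_square sum_product)
  qed
  also have "\<dots> \<ge> D\<^sup>2 / n"
  proof -
    have "D\<^sup>2 \<le> (\<Sum>z\<in>W. (\<Sum>x\<in>A. a x z)\<^sup>2) * real (card W)"
      unfolding D_eq by (rule sum_squared_le_sum_of_squares)
    also have "\<dots> \<le> (\<Sum>z\<in>W. (\<Sum>x\<in>A. a x z)\<^sup>2) * n"
      using n by (intro mult_left_mono sum_nonneg) auto
    finally show ?thesis
      using n by (simp add: field_simps)
  qed
  finally have lower: "D\<^sup>2 / n \<le> (\<Sum>x\<in>A. \<Sum>y\<in>A. real (codeg E x y))" .
  have "(\<Sum>x\<in>A. \<Sum>y\<in>A. real (codeg E x y)) = D + (\<Sum>x\<in>A. \<Sum>y\<in>A - {x}. real (codeg E x y))"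
  proof -
    have "(\<Sum>y\<in>A. real (codeg E x y))
        = real (card (nbrs E x)) + (\<Sum>y\<in>A - {x}. real (codeg E x y))" if "x \<in> A" for x
      using fin that by (subst sum.remove[of A x]) (auto simp: codeg_def)
    then show ?thesis
      by (simp add: D_def sum.distrib)
  qed
  also have "(\<Sum>x\<in>A. \<Sum>y\<in>A - {x}. real (codeg E x y)) < (\<Sum>x\<in>A. d\<^sup>2 / (2 * n) * real (card A))"
    using neg fin \<open>A \<noteq> {}\<close> by (intro sum_strict_mono) (auto simp: not_le)
  also have "\<dots> = (d * real (card A))\<^sup>2 / (2 * n)"
    by (simp add: power2_eq_square)
  also have "\<dots> \<le> D\<^sup>2 / (2 * n)"
    using D_ge n d by (intro divide_right_mono power_mono) auto
  finally have "D\<^sup>2 / (2 * n) < D"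
    using lower by (simp add: field_simps)
  then have "D * D < D * (2 * n)"
    using n by (simp add: field_simps power2_eq_square)
  then show False
    using \<open>2 * n \<le> D\<close> n by (simp add: mult_less_cancel_left)
qed

section \<open>The neighbourhood of a vertex of minimum degree\<close>

text \<open>
  These conditions are necessary for \<open>N\<close> to be the neighbourhood of a vertex \<open>v\<close> that is added to the
  graph \<open>E\<close> on \<open>W\<close> and has minimum degree in the resulting locally sparse graph. The summand 1 allows
  for the edge from \<open>y\<close> to \<open>v\<close>. The sum over \<open>N - {x}\<close> counts the 4-cycles through the new edge
  \<open>{v, x}\<close>.
\<close>

definition new_nbhds :: "real \<Rightarrow> 'a set \<Rightarrow> 'a set set \<Rightarrow> 'a set set" where
  "new_nbhds T W E = {N. N \<subseteq> W \<and> (\<forall>y\<in>W. card N \<le> card (nbrs E y) + 1) \<and>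
     (\<forall>x\<in>N. (\<Sum>y\<in>N - {x}. real (codeg E x y)) \<le> T)}"

lemma nbrs_in_new_nbhds:
  assumes E: "E \<in> locally_sparse T W" and v: "v \<in> W"
    and min: "\<And>y. y \<in> W \<Longrightarrow> card (nbrs E v) \<le> card (nbrs E y)"
  defines "E' \<equiv> {e \<in> E. v \<notin> e}"
  shows "nbrs E v \<in> new_nbhds T (W - {v}) E'"
proof -
  have G: "simple_graph (W, E)"
    using E by (simp add: locally_sparse_def)
  have nbrs': "nbrs E' y = nbrs E y - {v}" if "y \<noteq> v" for y
    using that by (auto simp: E'_def nbrs_def)
  have "card (nbrs E v) \<le> card (nbrs E' y) + 1" if "y \<in> W - {v}" for y
  proof -
    have "card (nbrs E y) \<le> card (nbrs E y - {v}) + 1"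
      using card_Diff1_le[of "nbrs E y" v] finite_nbrs[OF G] by (cases "v \<in> nbrs E y") auto
    then show ?thesis
      using min[of y] nbrs'[of y] that by simp
  qed
  moreover have "(\<Sum>y\<in>nbrs E v - {x}. real (codeg E' x y)) \<le> T" if x: "x \<in> nbrs E v" for x
  proof -
    have xv: "x \<noteq> v"
      using x nbrs_subset[OF G] by auto
    have "(\<Sum>y\<in>nbrs E v - {x}. codeg E' x y)
        = card (SIGMA y:nbrs E v - {x}. nbrs E' x \<inter> nbrs E' y)"
      using finite_nbrs[OF G] nbrs_subset[OF G] xv
      by (subst card_SigmaI) (auto simp: codeg_def nbrs')
    also have "\<dots> \<le> card (C4s_through E v x)"
      using xv nbrs_subset[OF G]
      by (intro card_mono finite_C4s_through[OF G])
         (auto simp: C4s_through_def E'_def nbrs_def insert_commute)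
    finally have "(\<Sum>y\<in>nbrs E v - {x}. codeg E' x y) \<le> card (C4s_through E v x)" .
    moreover have "real (card (C4s_through E v x)) \<le> T"
      using E x by (auto simp: locally_sparse_def nbrs_iff)
    ultimately show ?thesis
      by (metis of_nat_le_iff of_nat_sum order_trans)
  qed
  ultimately show ?thesis
    using nbrs_subset[OF G, of v] by (auto simp: new_nbhds_def)
qed

text \<open>
  Let \<open>k\<close> be the largest size of a candidate and \<open>d = k - 1\<close>, a lower bound for all degrees. If
  \<open>d \<le> sqrt n / log n\<close>, counting all sets of size \<open>k\<close> or less is enough. Otherwise the
  Kleitman--Winston lemma with codegrees as weights applies. The midpoint count gives
  the density \<open>d\<^sup>2 / (2 * n) \<ge> 1 / (2 * L\<^sup>2)\<close> in every set of at least \<open>2 * n / d\<close> vertices, and a smaller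
  set has at most \<open>exp (4 * sqrt n)\<close> subsets of size at most \<open>k \<le> 2 * d\<close>, whatever \<open>d\<close> is.
\<close>

lemma card_new_nbhds_le:
  fixes T :: real
  assumes n: "2 \<le> n" and W: "finite W" "card W \<le> n" and T: "0 \<le> T"
    and E: "E \<in> locally_sparse T W"
  defines "L \<equiv> log 2 (real n)"
  shows "real (card (new_nbhds T W E))
    \<le> (real n + 1) powr (1 + sqrt (real n) / L + 2 * L\<^sup>2 * (2 * T + 1) * ln (real n))
        * exp (4 * sqrt (real n))"
proof -
  define s where "s = sqrt (real n)"
  define Q where "Q = 2 * L\<^sup>2 * (2 * T + 1) * ln (real n)"
  define k where "k = Max (card ` new_nbhds T W E)"
  have L: "1 \<le> L"
    using n by (simp add: L_def)
  have s: "0 < s" "s\<^sup>2 = real n"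
    using n by (auto simp: s_def)
  have Q: "0 \<le> Q"
    using T n by (simp add: Q_def)
  have fin: "finite (new_nbhds T W E)"
    using W by (auto simp: new_nbhds_def)
  have "{} \<in> new_nbhds T W E"
    using T by (simp add: new_nbhds_def)
  then have "k \<in> card ` new_nbhds T W E"
    unfolding k_def using fin by (intro Max_in) auto
  then obtain N where N: "N \<in> new_nbhds T W E" "k = card N"
    by auto
  have "k \<le> card W"
    using N W by (auto simp: new_nbhds_def intro: card_mono)
  have deg: "k \<le> card (nbrs E y) + 1" if "y \<in> W" for y
    using N that by (auto simp: new_nbhds_def)
  have le_k: "card N \<le> k" if "N \<in> new_nbhds T W E" for N
    using fin that by (simp add: k_def)
  have "real (card (new_nbhds T W E)) \<le> (real n + 1) powr (1 + s / L + Q) * exp (4 * s)"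
  proof (cases "real k \<le> 1 + s / L")
    case True
    have "card (new_nbhds T W E) \<le> card {B. B \<subseteq> W \<and> card B \<le> k}"
      using W le_k by (intro card_mono) (auto simp: new_nbhds_def)
    also have "\<dots> \<le> (card W + 1) ^ k"
      using W(1) by (rule card_subsets_le_power)
    also have "\<dots> \<le> (n + 1) ^ k"
      using W by (intro power_mono) auto
    finally have "real (card (new_nbhds T W E)) \<le> real ((n + 1) ^ k)"
      by (rule of_nat_mono)
    also have "\<dots> = (real n + 1) powr real k"
      by (simp add: powr_realpow add.commute)
    also have "\<dots> \<le> (real n + 1) powr (1 + s / L + Q)"
      using True Q by (intro powr_mono) auto
    also have "\<dots> \<le> (real n + 1) powr (1 + s / L + Q) * exp (4 * s)"
      using s by (simp add: mult_le_cancel_left1)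
    finally show ?thesis .
  next
    case False
    define d where "d = real k - 1"
    define R where "R = 2 * real n / d"
    define B where "B = T + 1"
    \<comment> \<open>The lower bound for \<open>d\<^sup>2 / (2 * n)\<close> in this case; using it in place of that ratio
      also ensures \<open>\<beta> \<le> 1 \<le> T + B\<close>.\<close>
    define \<beta> where "\<beta> = 1 / (2 * L\<^sup>2)"
    define q where "q = nat \<lceil>Q\<rceil>"
    define M where "M = exp (4 * s)"
    have "0 < s / L"
      using s L by simp
    then have d: "1 \<le> d" "s / L < d" "d \<le> real n"
      using False \<open>k \<le> card W\<close> W by (auto simp: d_def)
    have "s \<le> d * L"
      using d L by (simp add: field_simps)
    then have "s\<^sup>2 \<le> (d * L)\<^sup>2"
      using s by (intro power_mono) auto
    then have \<beta>_le: "\<beta> \<le> d\<^sup>2 / (2 * real n)"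
      using s L n by (simp add: \<beta>_def field_simps power_mult_distrib)
    have "1 \<le> L\<^sup>2"
      using L by simp
    then have "1 / (2 * L\<^sup>2) \<le> 1 / 1"
      by (intro divide_left_mono) auto
    then have \<beta>: "0 < \<beta>" "\<beta> \<le> 1"
      using L by (auto simp: \<beta>_def)
    have R: "2 \<le> R"
      using d n by (simp add: R_def field_simps)
    have dense: "\<exists>v\<in>C. \<beta> * real (card C) \<le> (\<Sum>y\<in>C - {v}. real (codeg E v y))"
      if "C \<subseteq> W" "R \<le> real (card C)" for C
    proof -
      have "\<exists>v\<in>C. d\<^sup>2 / (2 * real n) * real (card C) \<le> (\<Sum>y\<in>C - {v}. real (codeg E v y))"
      proof (rule exists_large_codeg_sum)
        show "d \<le> real (card (nbrs E x))" if "x \<in> W" for x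
          using deg[OF that] by (simp add: d_def)
      qed (use E W n d that in \<open>auto simp: locally_sparse_def R_def\<close>)
      then show ?thesis
        using mult_right_mono[OF \<beta>_le, of "real (card C)"] by force
    qed
    have small: "real (card {N. N \<subseteq> C \<and> card N \<le> k}) \<le> M"
      if "C \<subseteq> W" "real (card C) < R" for C
    proof -
      have "real (card C) * real k \<le> R * (2 * d)"
        using that d by (intro mult_mono) (auto simp: d_def)
      also have "\<dots> = (2 * s)\<^sup>2"
        using d s by (simp add: R_def)
      finally have "sqrt (real (card C) * real k) \<le> 2 * s"
        using s by (intro real_le_lsqrt) auto
      then have "exp (2 * sqrt (real (card C) * real k)) \<le> M"
        by (simp add: M_def)
      moreover have "finite C"
        using that W by (auto dest: finite_subset)
      ultimately show ?thesis
        using card_subsets_le_exp_sqrt[of C k] by linarith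
    qed
    \<comment> \<open>The initial potential is at most \<open>n * S\<close> and \<open>S < 2 * B \<le> B * R\<close>, so \<open>q\<close> is chosen to make
      \<open>(1 - \<beta> / S) ^ q \<le> 1 / n\<close>.\<close>
    have potential: "(\<Sum>x\<in>W. T + B - 0) * (1 - \<beta> / (T + B)) ^ q < B * R"
    proof -
      define S where "S = T + B"
      have S: "1 \<le> S" "S < B * 2"
        using T by (auto simp: S_def B_def)
      have x: "0 \<le> \<beta> / S" "\<beta> / S \<le> 1"
        using \<beta> S by auto
      have "ln (real n) = Q * (\<beta> / S)"
        using L S by (simp add: Q_def \<beta>_def S_def B_def)
      also have "\<dots> \<le> real q * (\<beta> / S)"
        using x by (intro mult_right_mono) (auto simp: q_def real_nat_ceiling_ge)
      finally have "exp (ln (real n)) \<le> exp (real q * (\<beta> / S))"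
        by (subst exp_le_cancel_iff)
      then have "real n \<le> exp (real q * (\<beta> / S))"
        using n by simp
      moreover have "(1 - \<beta> / S) ^ q \<le> exp (- (\<beta> / S)) ^ q"
        using x exp_ge_add_one_self[of "- (\<beta> / S)"] by (intro power_mono) auto
      then have "(1 - \<beta> / S) ^ q \<le> exp (- (real q * (\<beta> / S)))"
        by (simp flip: exp_of_nat_mult)
      ultimately have "real n * (1 - \<beta> / S) ^ q
          \<le> exp (real q * (\<beta> / S)) * exp (- (real q * (\<beta> / S)))"
        using x by (intro mult_mono) auto
      then have one: "real n * (1 - \<beta> / S) ^ q \<le> 1"
        by (simp flip: exp_add)
      have "(\<Sum>x\<in>W. S) * (1 - \<beta> / S) ^ q \<le> (real n * S) * (1 - \<beta> / S) ^ q"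
        using W S x by (intro mult_right_mono) auto
      also have "\<dots> \<le> S"
        using mult_left_mono[OF one, of S] S by (simp add: mult_ac)
      also have "\<dots> < B * R"
        using S mult_left_mono[OF R, of B] T by (simp add: B_def)
      finally show ?thesis
        by (simp add: S_def)
    qed
    have "new_nbhds T W E \<subseteq> light_sets (\<lambda>x y. real (codeg E x y)) T k (\<lambda>_. 0) W"
      using le_k by (auto simp: light_sets_def new_nbhds_def)
    then have "card (new_nbhds T W E)
        \<le> card (light_sets (\<lambda>x y. real (codeg E x y)) T k (\<lambda>_. 0) W)"
      by (intro card_mono finite_light_sets W)
    then have "real (card (new_nbhds T W E))
        \<le> real (card (light_sets (\<lambda>x y. real (codeg E x y)) T k (\<lambda>_. 0) W))"
      by (rule of_nat_mono)
    also have "\<dots> \<le> (real (card W) + 1) ^ q * M"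
    proof (rule card_light_sets_le[where B = B and \<beta> = \<beta> and R = R])
      show "real (codeg E x y) \<le> B" if "x \<noteq> y" for x y
        using codeg_le[OF E that T] by (simp add: B_def)
      show "real (codeg E x y) = real (codeg E y x)" for x y
        by (simp add: codeg_commute)
    qed (use W(1) T \<beta> dense small potential in \<open>auto simp: B_def M_def\<close>)
    also have "\<dots> \<le> (real n + 1) powr real q * M"
      using W by (auto simp: M_def powr_realpow intro!: mult_right_mono power_mono)
    also have "\<dots> \<le> (real n + 1) powr (1 + s / L + Q) * M"
    proof -
      have "real q = real_of_int \<lceil>Q\<rceil>"
        using Q by (simp add: q_def)
      then have "real q \<le> 1 + s / L + Q"
        using of_int_ceiling_le_add_one[of Q] \<open>0 < s / L\<close> by linarith
      then show ?thesis
        by (intro mult_right_mono powr_mono) (auto simp: M_def)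
    qed
    finally show ?thesis
      by (simp add: M_def)
  qed
  then show ?thesis
    by (simp add: s_def Q_def)
qed

section \<open>Counting locally sparse graphs\<close>

text \<open>
  Deleting a vertex \<open>v\<close> of minimum degree leaves a locally sparse graph, from which the original one is
  recovered by \<open>v\<close> and its neighbourhood. So each vertex contributes a factor of at most \<open>n * K\<close>.
\<close>

lemma card_locally_sparse_le:
  fixes K :: real and W :: "'a set"
  assumes step: "\<And>(V :: 'a set) E. finite V \<Longrightarrow> card V \<le> n \<Longrightarrow> E \<in> locally_sparse T V \<Longrightarrow>
      real (card (new_nbhds T V E)) \<le> K"
    and "finite W" "card W \<le> n"
  shows "real (card (locally_sparse T W)) \<le> (real n * K) ^ card W"
  using assms(2,3)
proof (induction "card W" arbitrary: W)
  case 0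
  then have "W = {}"
    by simp
  then have "locally_sparse T W \<subseteq> {{}}"
    by (fastforce simp: locally_sparse_def simple_graph_def)
  then have "card (locally_sparse T W) \<le> card {{} :: 'a set set}"
    by (intro card_mono) auto
  then show ?case
    using \<open>W = {}\<close> by simp
next
  case (Suc m)
  have "{} \<in> locally_sparse T ({} :: 'a set)"
    by (simp add: locally_sparse_def simple_graph_def)
  then have "real (card (new_nbhds T {} ({} :: 'a set set))) \<le> K"
    by (intro step) auto
  then have K: "0 \<le> K"
    by linarith
  have fin: "finite (locally_sparse T V)" if "finite V" for V :: "'a set"
  proof (rule finite_subset)
    show "locally_sparse T V \<subseteq> Pow (Pow V)"
      by (auto simp: locally_sparse_def simple_graph_def)
  qed (use that in simp)
  have finN: "finite (new_nbhds T V E)" if "finite V" for V :: "'a set" and E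
    using that by (auto simp: new_nbhds_def)
  define ext where "ext v E N = E \<union> (\<lambda>x. {v, x}) ` N" for v :: 'a and E N
  have "locally_sparse T W
      \<subseteq> (\<Union>v\<in>W. \<Union>E\<in>locally_sparse T (W - {v}). ext v E ` new_nbhds T (W - {v}) E)"
  proof
    fix E
    assume E: "E \<in> locally_sparse T W"
    then have G: "simple_graph (W, E)"
      by (simp add: locally_sparse_def)
    have "W \<noteq> {}"
      using Suc by auto
    then obtain v where v: "v \<in> W" "\<And>y. y \<in> W \<Longrightarrow> card (nbrs E v) \<le> card (nbrs E y)"
      using ex_min_if_finite[of "(\<lambda>y. card (nbrs E y)) ` W"] Suc.prems by (force simp: not_less)
    define E' where "E' = {e \<in> E. v \<notin> e}"
    have "E' \<in> locally_sparse T (W - {v})"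
      using G by (intro locally_sparse_mono[OF E]) (auto simp: E'_def simple_graph_def)
    moreover have "nbrs E v \<in> new_nbhds T (W - {v}) E'"
      unfolding E'_def using E v by (intro nbrs_in_new_nbhds)
    moreover have "E = ext v E' (nbrs E v)"
    proof -
      have "e \<in> (\<lambda>x. {v, x}) ` nbrs E v" if e: "e \<in> E" "v \<in> e" for e
      proof -
        have "card e = 2"
          using G e by (auto simp: simple_graph_def)
        then obtain a b where "e = {a, b}"
          by (auto simp: card_2_iff)
        then obtain x where "e = {v, x}"
          using e by (cases "v = a") auto
        then show ?thesis
          using e by (auto simp: nbrs_def)
      qed
      then show ?thesis
        by (auto simp: ext_def E'_def nbrs_def)
    qed
    ultimately show "E \<in> (\<Union>v\<in>W. \<Union>E\<in>locally_sparse T (W - {v}). ext v E ` new_nbhds T (W - {v}) E)"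
      using v(1) by blast
  qed
  then have "card (locally_sparse T W)
      \<le> card (\<Union>v\<in>W. \<Union>E\<in>locally_sparse T (W - {v}). ext v E ` new_nbhds T (W - {v}) E)"
    using Suc.prems fin finN by (intro card_mono) auto
  also have "\<dots> \<le> (\<Sum>v\<in>W. card (\<Union>E\<in>locally_sparse T (W - {v}). ext v E ` new_nbhds T (W - {v}) E))"
    using Suc.prems by (intro card_UN_le)
  also have "\<dots> \<le> (\<Sum>v\<in>W. \<Sum>E\<in>locally_sparse T (W - {v}). card (ext v E ` new_nbhds T (W - {v}) E))"
    using Suc.prems fin by (intro sum_mono card_UN_le) auto
  also have "\<dots> \<le> (\<Sum>v\<in>W. \<Sum>E\<in>locally_sparse T (W - {v}). card (new_nbhds T (W - {v}) E))"
    using Suc.prems finN by (intro sum_mono card_image_le) auto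
  finally have "real (card (locally_sparse T W))
      \<le> (\<Sum>v\<in>W. \<Sum>E\<in>locally_sparse T (W - {v}). real (card (new_nbhds T (W - {v}) E)))"
    by (simp flip: of_nat_sum)
  also have "\<dots> \<le> (\<Sum>v\<in>W. \<Sum>E\<in>locally_sparse T (W - {v}). K)"
    using Suc.prems Suc.hyps(2) by (intro sum_mono step) auto
  also have "\<dots> = (\<Sum>v\<in>W. real (card (locally_sparse T (W - {v}))) * K)"
    by simp
  also have "\<dots> \<le> (\<Sum>v\<in>W. (real n * K) ^ m * K)"
  proof -
    have "real (card (locally_sparse T (W - {v}))) \<le> (real n * K) ^ m" if "v \<in> W" for v
    proof -
      have "card (W - {v}) = m"
        using Suc.hyps(2)[symmetric] Suc.prems that by simp
      then show ?thesis
        using Suc.hyps(1)[of "W - {v}"] Suc.hyps(2) Suc.prems by simp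
    qed
    then show ?thesis
      using K by (intro sum_mono mult_right_mono) auto
  qed
  also have "\<dots> = real (card W) * K * (real n * K) ^ m"
    by simp
  also have "\<dots> \<le> real n * K * (real n * K) ^ m"
    using Suc.prems K by (intro mult_right_mono) auto
  finally show ?case
    using Suc.hyps(2) by (metis power_Suc)
qed

section \<open>From few 4-cycles to local sparsity\<close>

definition C4_tuples :: "'a set set \<Rightarrow> (('a \<times> 'a) \<times> ('a \<times> 'a)) set" where
  "C4_tuples E = (SIGMA (v, x):{(v, x). {v, x} \<in> E}. C4s_through E v x)"

lemma finite_C4_tuples:
  assumes "simple_graph (W, E)"
  shows "finite (C4_tuples E)"
proof (rule finite_subset)
  show "C4_tuples E \<subseteq> (W \<times> W) \<times> (W \<times> W)"
    using edge_ends[OF assms] by (auto simp: C4_tuples_def C4s_through_def)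
  show "finite ((W \<times> W) \<times> (W \<times> W))"
    using assms by (simp add: simple_graph_def)
qed

lemma cycle_graph_4: "cycle_graph 4 = ({0, 1, 2, 3}, {{0, 1}, {1, 2}, {2, 3}, {3, 0}})"
proof -
  have "{..<4::nat} = {0, 1, 2, 3}"
    by auto
  moreover have "{{i, Suc i mod 4} | i. i < 4} = (\<lambda>i. {i, Suc i mod 4}) ` {..<4}"
    by auto
  ultimately show ?thesis
    by (simp add: cycle_graph_def flip: numeral_2_eq_2)
qed

definition tuple_graph :: "('a \<times> 'a) \<times> ('a \<times> 'a) \<Rightarrow> 'a graph" where
  "tuple_graph = (\<lambda>((v, x), (y, z)). ({v, y, z, x}, {{v, y}, {y, z}, {z, x}, {x, v}}))"

lemma tuple_graph_in_cycles:
  assumes G: "simple_graph (W, E)" and t: "t \<in> C4_tuples E"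
  shows "tuple_graph t \<in> cycles_of_length 4 (W, E)"
proof -
  obtain v x y z where t_eq: "t = ((v, x), (y, z))"
    by (cases t) auto
  have e: "{v, y} \<in> E" "{y, z} \<in> E" "{z, x} \<in> E" "{x, v} \<in> E" and ne: "y \<noteq> x" "z \<noteq> v"
    using t by (auto simp: t_eq C4_tuples_def C4s_through_def insert_commute)
  note d = edge_ends[OF G e(1)] edge_ends[OF G e(2)] edge_ends[OF G e(3)] edge_ends[OF G e(4)]
  define H where "H = ({v, y, z, x}, {{v, y}, {y, z}, {z, x}, {x, v}})"
  have "subgraph H (W, E)"
    using d e by (auto simp: H_def subgraph_def simple_graph_def)
  moreover have "graph_isomorphic H (cycle_graph 4)"
    unfolding graph_isomorphic_def cycle_graph_4
  proof (intro exI conjI)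
    define f where "f u = (if u = v then 0 else if u = y then 1 else if u = z then 2 else 3 :: nat)"
      for u
    have f: "f v = 0" "f y = 1" "f z = 2" "f x = 3"
      using d ne by (auto simp: f_def)
    show "bij_betw f (verts H) (verts ({0, 1, 2, 3}, {{0, 1}, {1, 2}, {2, 3}, {3, 0}}))"
      using f by (simp add: bij_betw_def inj_on_def H_def)
    show "(`) f ` edges H = edges ({0, 1, 2, 3}, {{0, 1}, {1, 2}, {2, 3}, {3, 0}})"
      using f by (simp add: H_def)
  qed
  ultimately show ?thesis
    by (simp add: cycles_of_length_def t_eq tuple_graph_def H_def)
qed

text \<open>
  The four entries of a tuple are vertices of its cycle, and the cycle has only four vertices; hence at
  most \<open>4 ^ 4\<close> tuples give the same cycle.
\<close>

lemma card_C4_tuples_le: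
  assumes G: "simple_graph (W, E)"
  shows "card (C4_tuples E) \<le> 256 * card (cycles_of_length 4 (W, E))"
proof -
  define fib where "fib H = {t. tuple_graph t = H}" for H :: "'a graph"
  have fib: "finite (fib H)" "card (fib H) \<le> 256" if H: "H \<in> cycles_of_length 4 (W, E)" for H
  proof -
    define S where "S = verts H"
    have "graph_isomorphic H (cycle_graph 4)"
      using H by (simp add: cycles_of_length_def)
    then obtain f where "bij_betw f S (verts (cycle_graph 4))"
      unfolding graph_isomorphic_def S_def by blast
    then have "bij_betw f S {0, 1, 2, 3}"
      by (simp add: cycle_graph_4)
    then have S: "finite S" "card S = 4"
      using bij_betw_finite bij_betw_same_card by fastforce+
    have sub: "fib H \<subseteq> (S \<times> S) \<times> (S \<times> S)"
      by (auto simp: fib_def tuple_graph_def S_def)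
    have fin: "finite ((S \<times> S) \<times> (S \<times> S))"
      using S by simp
    show "finite (fib H)"
      using sub fin by (rule finite_subset)
    have "card (fib H) \<le> card ((S \<times> S) \<times> (S \<times> S))"
      by (intro card_mono sub fin)
    also have "\<dots> = 256"
      using S by (simp add: card_cartesian_product)
    finally show "card (fib H) \<le> 256" .
  qed
  have finC: "finite (cycles_of_length 4 (W, E))"
    using G by (rule finite_cycles_of_length)
  have "C4_tuples E \<subseteq> (\<Union>H\<in>cycles_of_length 4 (W, E). fib H)"
    using tuple_graph_in_cycles[OF G] by (auto simp: fib_def)
  then have "card (C4_tuples E) \<le> card (\<Union>H\<in>cycles_of_length 4 (W, E). fib H)"
    using finC fib by (intro card_mono) auto
  also have "\<dots> \<le> (\<Sum>H\<in>cycles_of_length 4 (W, E). card (fib H))"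
    using finC by (rule card_UN_le)
  also have "\<dots> \<le> (\<Sum>H\<in>cycles_of_length 4 (W, E). 256)"
    using fib by (intro sum_mono) auto
  finally show ?thesis
    by simp
qed

definition heavy_edges :: "real \<Rightarrow> 'a set set \<Rightarrow> 'a set set" where
  "heavy_edges T E = {{v, x} | v x. {v, x} \<in> E \<and> T < real (card (C4s_through E v x))}"

lemma card_heavy_edges_le:
  assumes G: "simple_graph (W, E)" and "0 \<le> T"
  shows "real (card (heavy_edges T E)) * T \<le> real (card (C4_tuples E))"
proof -
  define P where "P = {(v, x). {v, x} \<in> E \<and> T < real (card (C4s_through E v x))}"
  have "P \<subseteq> W \<times> W"
    unfolding P_def using edge_ends(1,2)[OF G] by blast
  moreover have "finite (W \<times> W)"
    using G by (simp add: simple_graph_def)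
  ultimately have fin: "finite P"
    by (rule finite_subset)
  have "heavy_edges T E = (\<lambda>(v, x). {v, x}) ` P"
    by (auto simp: heavy_edges_def P_def)
  then have "card (heavy_edges T E) \<le> card P"
    using fin by (simp add: card_image_le)
  then have "real (card (heavy_edges T E)) * T \<le> real (card P) * T"
    using \<open>0 \<le> T\<close> by (intro mult_right_mono) auto
  also have "\<dots> = (\<Sum>p\<in>P. T)"
    by simp
  also have "\<dots> \<le> (\<Sum>p\<in>P. real (card (case p of (v, x) \<Rightarrow> C4s_through E v x)))"
    by (intro sum_mono) (auto simp: P_def)
  also have "\<dots> = real (card (SIGMA p:P. case p of (v, x) \<Rightarrow> C4s_through E v x))"
    using fin finite_C4s_through[OF G] by (subst card_SigmaI) auto
  also have "\<dots> \<le> real (card (C4_tuples E))"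
    using finite_C4_tuples[OF G]
    by (intro of_nat_mono card_mono) (auto simp: C4_tuples_def P_def)
  finally show ?thesis .
qed

lemma delete_heavy_edges:
  assumes G: "simple_graph (W, E)"
  shows "E - heavy_edges T E \<in> locally_sparse T W"
proof -
  have "real (card (C4s_through (E - heavy_edges T E) v x)) \<le> T"
    if "{v, x} \<in> E - heavy_edges T E" for v x
  proof -
    have "card (C4s_through (E - heavy_edges T E) v x) \<le> card (C4s_through E v x)"
      by (intro card_mono finite_C4s_through[OF G] C4s_through_mono) auto
    moreover have "real (card (C4s_through E v x)) \<le> T"
      using that by (force simp: heavy_edges_def)
    ultimately show ?thesis
      by linarith
  qed
  then show ?thesis
    using G by (auto simp: locally_sparse_def simple_graph_def)
qed

text \<open>
  A graph is determined by its heavy edges together with the locally sparse graph that remains when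
  they are deleted, and double counting pairs of an edge and a 4-cycle through it shows that the heavy
  edges are few.
\<close>

lemma card_few_C4s_le:
  fixes V :: "'a set" and c T :: real
  assumes V: "finite V" and T: "0 < T"
  defines "m \<equiv> nat \<lfloor>256 * c / T\<rfloor>"
  shows "card {G \<in> graphs_on V. real (card (cycles_of_length 4 G)) \<le> c}
    \<le> card (locally_sparse T V) * ((card V choose 2) + 1) ^ m"
proof -
  define P where "P = {e. e \<subseteq> V \<and> card e = 2}"
  define F where "F = {B. B \<subseteq> P \<and> card B \<le> m}"
  define \<G> where "\<G> = {G \<in> graphs_on V. real (card (cycles_of_length 4 G)) \<le> c}"
  define split where
    "split G = (edges G - heavy_edges T (edges G), heavy_edges T (edges G))" for G :: "'a graph"
  have P: "finite P" "card P = card V choose 2"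
    using V by (auto simp: P_def n_subsets)
  have "finite (locally_sparse T V)"
    by (rule finite_subset[of _ "Pow (Pow V)"]) (use V in \<open>auto simp: locally_sparse_def simple_graph_def\<close>)
  moreover have "finite F"
    using P by (auto simp: F_def)
  ultimately have fin: "finite (locally_sparse T V \<times> F)"
    by simp
  have heavy_subset: "heavy_edges T E \<subseteq> E" for E :: "'a set set"
    by (auto simp: heavy_edges_def)
  have "inj_on split \<G>"
  proof (rule inj_onI)
    fix G H
    assume "G \<in> \<G>" "H \<in> \<G>" "split G = split H"
    then have "verts G = verts H" "edges G = edges H"
      using heavy_subset[of "edges G"] heavy_subset[of "edges H"]
      by (auto simp: split_def \<G>_def graphs_on_def)
    then show "G = H"
      by (simp add: prod_eq_iff)
  qed
  moreover have "split ` \<G> \<subseteq> locally_sparse T V \<times> F"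
  proof
    fix p
    assume "p \<in> split ` \<G>"
    then obtain G where G: "G \<in> \<G>" "p = split G"
      by blast
    obtain E where E: "G = (V, E)"
      using G by (cases G) (auto simp: \<G>_def graphs_on_def)
    have simple: "simple_graph (V, E)"
      using G by (simp add: E \<G>_def graphs_on_def)
    have "real (card (heavy_edges T E)) * T \<le> real (card (C4_tuples E))"
      using T by (intro card_heavy_edges_le[OF simple]) auto
    also have "\<dots> \<le> real (256 * card (cycles_of_length 4 (V, E)))"
      using card_C4_tuples_le[OF simple] by (rule of_nat_mono)
    also have "\<dots> \<le> 256 * c"
      using G by (simp add: E \<G>_def)
    finally have "real (card (heavy_edges T E)) \<le> 256 * c / T"
      using T by (simp add: field_simps)
    then have "card (heavy_edges T E) \<le> m"
      by (simp add: m_def le_nat_floor)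
    moreover have "E \<subseteq> P"
      using simple by (auto simp: simple_graph_def P_def)
    ultimately have "heavy_edges T E \<in> F"
      using heavy_subset[of E] by (auto simp: F_def)
    then show "p \<in> locally_sparse T V \<times> F"
      using delete_heavy_edges[OF simple, of T] by (simp add: G split_def E)
  qed
  ultimately have "card \<G> \<le> card (locally_sparse T V \<times> F)"
    using fin by (rule card_inj_on_le)
  also have "\<dots> = card (locally_sparse T V) * card F"
    by (rule card_cartesian_product)
  also have "\<dots> \<le> card (locally_sparse T V) * (card P + 1) ^ m"
    unfolding F_def by (intro mult_left_mono card_subsets_le_power P) auto
  finally show ?thesis
    by (simp add: \<G>_def P)
qed

section \<open>Asymptotics\<close>

lemma exp_4_le: "exp (4 * s) \<le> 2 powr (6 * s)" if "0 \<le> (s :: real)"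
proof -
  have "4 * s = 6 * s * (2 / 3)"
    by simp
  also have "\<dots> \<le> 6 * s * ln 2"
    using that ln2_ge_two_thirds by (intro mult_left_mono) auto
  finally show ?thesis
    by (simp add: powr_def mult_ac)
qed

text \<open>
  The second summand contributes about \<open>sqrt n\<close> to the left-hand side, because \<open>log 2 (n + 1)\<close> nearly
  cancels \<open>L\<close>. The other two are of smaller order: the exponent 5 in \<open>T\<close> leaves \<open>O(sqrt n / L)\<close>.
\<close>

lemma eventually_new_nbhds_bound:
  "eventually (\<lambda>n::nat. let L = log 2 (real n); T = 8 * sqrt (real n) / L ^ 5 in
      (1 + sqrt (real n) / L + 2 * L\<^sup>2 * (2 * T + 1) * ln (real n)) * log 2 (real n + 1)
        \<le> 2 * sqrt (real n)) at_top"
  unfolding Let_def log_def by real_asymp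

lemma eventually_log_le_sqrt: "eventually (\<lambda>n::nat. log 2 (real n) \<le> sqrt (real n)) at_top"
  unfolding log_def by real_asymp

theorem theorem1p4:
  shows "\<exists>n0::nat. \<forall>n\<ge>n0. \<forall>a::real. a = 32 * (log 2 (real n)) ^ 6 \<longrightarrow>
    real (card {G \<in> graphs_on {1..n}. real (card (cycles_of_length 4 G)) \<le> (real n)\<^sup>2 / a})
      \<le> 2 powr (11 * real n powr (3 / 2))"
proof -
  from eventually_new_nbhds_bound eventually_log_le_sqrt eventually_ge_at_top[of 2]
  have "eventually (\<lambda>n::nat. real (card {G \<in> graphs_on {1..n}. real (card (cycles_of_length 4 G)) \<le>
      (real n)\<^sup>2 / (32 * (log 2 (real n)) ^ 6)}) \<le> 2 powr (11 * real n powr (3 / 2))) at_top"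
  proof eventually_elim
    case (elim n)
    define L where "L = log 2 (real n)"
    define s where "s = sqrt (real n)"
    \<comment> \<open>With this \<open>T\<close> the number of heavy edges is at most \<open>256 * c / T = n * s / L\<close>.\<close>
    define T where "T = 8 * s / L ^ 5"
    have n: "2 \<le> n" and "L \<le> s"
      using elim by (auto simp: L_def s_def)
    have L: "1 \<le> L"
      using n by (simp add: L_def)
    have s: "0 < s" "s * s = real n"
      using n by (auto simp: s_def)
    have T: "0 < T"
      using s L by (simp add: T_def)
    have two_powr: "2 powr L = real n"
      using n by (simp add: L_def)
    define c where "c = (real n)\<^sup>2 / (32 * L ^ 6)"
    define m where "m = nat \<lfloor>256 * c / T\<rfloor>"
    have "256 * c / T = (s * s)\<^sup>2 / (s * L)"
      using s(1) L by (simp add: c_def T_def s(2) field_simps eval_nat_numeral)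
    also have "\<dots> = s * s * s / L"
      using s(1) L by (simp add: power2_eq_square)
    also have "\<dots> = real n * s / L"
      by (simp add: s(2))
    finally have c: "256 * c / T = real n * s / L" .
    have "real m \<le> real n * s / L"
      unfolding m_def c using s L by (intro of_nat_floor) simp
    then have m: "L * real m \<le> real n * s"
      using L by (simp add: field_simps)
    have "real (card (new_nbhds T W E)) \<le> 2 powr (8 * s)"
      if W: "finite W" "card W \<le> n" and E: "E \<in> locally_sparse T W" for W :: "nat set" and E
    proof -
      define X where "X = 1 + s / L + 2 * L\<^sup>2 * (2 * T + 1) * ln (real n)"
      have "X * log 2 (real n + 1) \<le> 2 * s"
        using elim(1) by (simp add: Let_def X_def T_def s_def L_def)
      then have "2 powr (log 2 (real n + 1) * X) \<le> 2 powr (2 * s)"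
        by (intro powr_mono) (auto simp: mult.commute)
      then have "(real n + 1) powr X \<le> 2 powr (2 * s)"
        by (simp flip: powr_powr)
      then have "(real n + 1) powr X * exp (4 * s) \<le> 2 powr (2 * s) * 2 powr (6 * s)"
        using s by (intro mult_mono exp_4_le) auto
      moreover have "real (card (new_nbhds T W E)) \<le> (real n + 1) powr X * exp (4 * s)"
        using card_new_nbhds_le[OF n W _ E] T by (simp add: X_def s_def L_def)
      ultimately show ?thesis
        by (simp flip: powr_add)
    qed
    then have "real (card (locally_sparse T {1..n})) \<le> (real n * 2 powr (8 * s)) ^ n"
      using card_locally_sparse_le[of n T "2 powr (8 * s)" "{1..n}"] by simp
    also have "real n * 2 powr (8 * s) = 2 powr (L + 8 * s)"
      by (simp add: powr_add two_powr)
    also have "\<dots> ^ n = 2 powr ((L + 8 * s) * real n)"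
      by (simp add: powr_powr flip: powr_realpow)
    also have "\<dots> \<le> 2 powr (9 * (real n * s))"
      using mult_right_mono[OF \<open>L \<le> s\<close>, of "real n"] by (simp add: algebra_simps)
    finally have sparse: "real (card (locally_sparse T {1..n})) \<le> 2 powr (9 * (real n * s))" .
    have "(n choose 2) + 1 \<le> n * n"
      using n by (cases n) (auto simp: choose_two)
    then have "real (((n choose 2) + 1) ^ m) \<le> real ((n * n) ^ m)"
      by (intro of_nat_mono power_mono) auto
    also have "real ((n * n) ^ m) = (2 powr (L + L)) ^ m"
      by (simp only: powr_add two_powr of_nat_power of_nat_mult)
    also have "\<dots> = 2 powr ((L + L) * real m)"
      by (simp add: powr_powr flip: powr_realpow)
    also have "\<dots> = 2 powr (2 * (L * real m))"
      by (simp add: mult.assoc)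
    also have "\<dots> \<le> 2 powr (2 * (real n * s))"
      using m by simp
    finally have heavy: "real (((n choose 2) + 1) ^ m) \<le> 2 powr (2 * (real n * s))" .
    have "card {G \<in> graphs_on {1..n}. real (card (cycles_of_length 4 G)) \<le> c}
        \<le> card (locally_sparse T {1..n}) * ((n choose 2) + 1) ^ m"
      using card_few_C4s_le[OF _ T, of "{1..n}" c] by (simp add: m_def)
    then have "real (card {G \<in> graphs_on {1..n}. real (card (cycles_of_length 4 G)) \<le> c})
        \<le> real (card (locally_sparse T {1..n}) * ((n choose 2) + 1) ^ m)"
      by (rule of_nat_mono)
    also have "\<dots> = real (card (locally_sparse T {1..n})) * real (((n choose 2) + 1) ^ m)"
      by (rule of_nat_mult)
    also have "\<dots> \<le> 2 powr (9 * (real n * s)) * 2 powr (2 * (real n * s))"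
      by (intro mult_mono sparse heavy) auto
    also have "\<dots> = 2 powr (11 * (real n * s))"
      by (simp add: mult.commute flip: powr_add)
    also have "real n * s = real n powr (3 / 2)"
      using n powr_add[of "real n" 1 "1 / 2"] by (simp add: s_def powr_half_sqrt)
    finally show ?case
      by (simp add: c_def L_def)
  qed
  then show ?thesis
    by (auto simp: eventually_at_top_linorder)
qed

end
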